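(* Let $C_1$ and $C_2$ be circles in the sphere $\mathbb{S}^2$ of radius $1$ with spherical radii $R_1,R_2\in(0,\pi)$ respectively, that are either (a) two gears attached to each other, moving by rotation movements with time domain $\{0,\dots,s\}$ that correspond to each other under the attachment, or (b) two pulleys attached by a tensioned belt, moving by corresponding rotation movements with time domain $[0,s]$. Let $\omega_i(t)$ be the angular velocity of $C_i$ at time $t$. Then $$\sin(R_1)\,\omega_1(t)=\sin(R_2)\,\omega_2(t)$$ for every $t\in\{1,\dots,s\}$ in case (a), and for every $t\in[0,s]$ in case (b).
   Context: Let $X=\mathbb{S}^2$ be the unit sphere in $\mathbb{R}^3$ with the induced Riemannian metric; $Isom(X)$ is its isometry group, and a rotation with center $c$ is an orientation-preserving isometry fixing $c$. A circle with center $c\in X$ and spherical radius $R$ is the set of points at spherical distance $R$ from $c$; the center is part of the data. GEARS. A gear is a geometric circumference $C$ in $X$ with center $c$, together with a division of $C$ into finitely many arcs $\{T^1,\dots,T^n\}$ (with endpoints) of the same length, written in cyclic order; the arcs are the teeth of $C$, and their order gives an orientation of $C$. A rotation movement of a gear is a map $(r,f):\{0,\dots,s\}\to Isom(X)\times\mathbb{Z}$ ($s$ a positive integer) with $r(0)=id_X$, $f(0)=0$, and such that for each $t$, $r(t)$ is a rotation with center $c$ that maps every tooth of $C$ to a tooth of $C$ (so its angle is an integer multiple of $2\pi/n$). The associated winding map is $\sigma(t)=\frac{\delta(p,r(t)(p))}{2\pi/n}+n f(t)\in\mathbb{Z}$, where $p\in C$ is any point (the value does not depend on $p$) and $\delta(p,r(t)(p))\in[0,2\pi)$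 is the oriented angle at $c$, with respect to the orientation of $C$, from the geodesic segment $\overline{c,p}$ to $\overline{c,r(t)(p)}$. The angular velocity of the gear is $\omega(t)=\frac{2\pi\sigma(t)}{n t}$ for $t\ne0$. Two gears whose teeth have the same arc length are attached if every rotation movement of one gear is transferred to a rotation movement of the other (with the same time domain) having the same associated winding map. PULLEYS. A pulley is a geometric circle $C$ in $X$, with center $c$. A rotation movement of a pulley is a differentiable map $r:[0,s]\to Isom(X)$ ($s>0$) with $r(0)=id_X$ and such that each $r(t)$ is a rotation with center $c$. For $p\in X$ put $r_p(t)=r(t)(p)$. The linear velocity of a differentiable path $\gamma:[0,s]\to X$ is $\gamma'$, with norm $\|\gamma'(t)\|_{\gamma(t)}$ given by the Riemannian metric. For a point $p\in X$ such that $\gamma$ avoids $p$ and its antipode, and a geodesic segment $\lambda$ starting at $p$, let $\alpha_{p,\lambda}(\gamma)(t)\in\mathbb{R}$ be the oriented angle at $p$ from $\lambda$ to the geodesic segment $\overline{p,\gamma(t)}$, chosen continuously in $t$; the angular velocity of $\gamma$ with respect to $p$ is $\omega_p(\gamma)(t)=|\alpha_{p,\lambda}(\gamma)'(t)|$ (independent of $\lambda$). The angular velocity of the pulley $C$ under the movement $r$ is $\omega(t)=\omega_c(r_p)(t)$ for any $p\in C$ (independent of $p$). Two pulleys attached by a tensioned belt, with no sliding, means: the rotation movements $r_1,r_2$ of $C_1,C_2$ on $[0,s]$ have linear velocities of the same norm at all times, i.e. $\|(r_1)_{p_1}'(t)\|=\|(r_2)_{p_2}'(t)\|$ for all $t\in[0,s]$,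 $p_1\in C_1$, $p_2\in C_2$. *)

theory Defs
  imports "HOL-Analysis.Analysis"
begin

section \<open>The unit sphere and its rotations\<close>

abbreviation S2 :: "(real^3) set" where
  "S2 \<equiv> sphere 0 1"

definition sdist :: "real^3 \<Rightarrow> real^3 \<Rightarrow> real" where
  "sdist x y = arccos (x \<bullet> y)"

definition sphere_circle :: "real^3 \<Rightarrow> real \<Rightarrow> (real^3) set" where
  "sphere_circle c R = {x \<in> S2. sdist c x = R}"

text \<open>Elements of the isometry group are functions on the ambient space of which only the
  values on the sphere matter.\<close>

definition sphere_isometry :: "(real^3 \<Rightarrow> real^3) \<Rightarrow> bool" where
  "sphere_isometry g \<longleftrightarrow>
     bij_betw g S2 S2 \<and> (\<forall>x\<in>S2. \<forall>y\<in>S2. sdist (g x) (g y) = sdist x y)"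

text \<open>The tangent space at \<open>x\<close> is the orthogonal complement of \<open>x\<close>; a basis \<open>u, v\<close> of it is
  positive iff \<open>x \<bullet> cross3 u v = det (x, u, v)\<close> is positive. The derivative is determined on the
  tangent space only.\<close>

definition orientation_preserving :: "(real^3 \<Rightarrow> real^3) \<Rightarrow> bool" where
  "orientation_preserving g \<longleftrightarrow>
     (\<forall>x\<in>S2. \<exists>g'. (g has_derivative g') (at x within S2) \<and>
        (\<forall>u v. x \<bullet> u = 0 \<and> x \<bullet> v = 0 \<and> x \<bullet> cross3 u v > 0 \<longrightarrow>
               g x \<bullet> cross3 (g' u) (g' v) > 0))"

definition rotation_about :: "real^3 \<Rightarrow> (real^3 \<Rightarrow> real^3) \<Rightarrow> bool" where
  "rotation_about c g \<longleftrightarrow> sphere_isometry g \<and> orientation_preserving g \<and> g c = c"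

text \<open>Initial unit tangent vector at \<open>c\<close> of the geodesic segment from \<open>c\<close> to \<open>p\<close>, for
  \<open>p \<noteq> c\<close> and \<open>p \<noteq> - c\<close>.\<close>

definition segment_dir :: "real^3 \<Rightarrow> real^3 \<Rightarrow> real^3" where
  "segment_dir c p = sgn (p - (c \<bullet> p) *\<^sub>R c)"

text \<open>Orientations of a circle with centre \<open>c\<close> are signs: \<open>1\<close> is the direction of
  \<open>cross3 c\<close> (a quarter turn in the tangent plane), \<open>-1\<close> the opposite one. The angle at \<open>c\<close> from
  \<open>p\<close> to \<open>q\<close> is the argument of the direction of \<open>q\<close> in the positive orthonormal frame
  starting with the direction of \<open>p\<close>.\<close>

definition oriented_angle :: "real \<Rightarrow> real^3 \<Rightarrow> real^3 \<Rightarrow> real^3 \<Rightarrow> real" where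
  "oriented_angle \<epsilon> c p q =
     Arg2pi (Complex (segment_dir c p \<bullet> segment_dir c q)
                     (\<epsilon> * (cross3 c (segment_dir c p) \<bullet> segment_dir c q)))"

text \<open>The point obtained by turning \<open>p\<close> about \<open>c\<close> by the angle \<open>\<phi>\<close> in the direction \<open>\<epsilon>\<close>.\<close>

definition turn :: "real \<Rightarrow> real^3 \<Rightarrow> real^3 \<Rightarrow> real \<Rightarrow> real^3" where
  "turn \<epsilon> c p \<phi> =
     (c \<bullet> p) *\<^sub>R c + cos \<phi> *\<^sub>R (p - (c \<bullet> p) *\<^sub>R c) + (\<epsilon> * sin \<phi>) *\<^sub>R cross3 c p"

definition curve_length :: "(real \<Rightarrow> real^3) \<Rightarrow> real \<Rightarrow> real \<Rightarrow> real" where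
  "curve_length \<gamma> a b = integral {a..b} (\<lambda>x. norm (vector_derivative \<gamma> (at x)))"

section \<open>Gears\<close>

text \<open>The teeth are the arcs cut out by the division angles, counted from the first endpoint
  \<open>gear_start\<close> of the first tooth in the direction of the gear. The orientation is recorded
  because for one or two teeth it cannot be read off from their cyclic order.\<close>

record gear =
  gear_center :: "real^3"
  gear_radius :: real
  gear_orient :: real
  gear_start :: "real^3"
  gear_size :: nat
  gear_angle :: "nat \<Rightarrow> real"

definition gear_circle :: "gear \<Rightarrow> (real^3) set" where
  "gear_circle G = sphere_circle (gear_center G) (gear_radius G)"

definition gear_path :: "gear \<Rightarrow> real \<Rightarrow> real^3" where
  "gear_path G = turn (gear_orient G) (gear_center G) (gear_start G)"

definition tooth :: "gear \<Rightarrow> nat \<Rightarrow> (real^3) set" where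
  "tooth G i = gear_path G ` {gear_angle G i..gear_angle G (Suc i)}"

definition tooth_ends :: "gear \<Rightarrow> nat \<Rightarrow> (real^3) set" where
  "tooth_ends G i = {gear_path G (gear_angle G i), gear_path G (gear_angle G (Suc i))}"

definition tooth_length :: "gear \<Rightarrow> nat \<Rightarrow> real" where
  "tooth_length G i = curve_length (gear_path G) (gear_angle G i) (gear_angle G (Suc i))"

definition is_gear :: "gear \<Rightarrow> bool" where
  "is_gear G \<longleftrightarrow>
     gear_center G \<in> S2 \<and> 0 < gear_radius G \<and> gear_radius G < pi \<and>
     gear_orient G \<in> {1, -1} \<and> gear_start G \<in> gear_circle G \<and>
     gear_size G \<ge> 1 \<and> gear_angle G 0 = 0 \<and> gear_angle G (gear_size G) = 2 * pi \<and>
     (\<forall>i<gear_size G. gear_angle G i < gear_angle G (Suc i)) \<and>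
     (\<forall>i<gear_size G. \<forall>j<gear_size G. tooth_length G i = tooth_length G j)"

text \<open>Teeth are arcs together with their endpoints; the condition on the endpoints only matters
  for a gear with a single tooth, whose underlying set is the whole circle.\<close>

definition maps_teeth_to_teeth :: "gear \<Rightarrow> (real^3 \<Rightarrow> real^3) \<Rightarrow> bool" where
  "maps_teeth_to_teeth G g \<longleftrightarrow>
     (\<forall>i<gear_size G. \<exists>j<gear_size G.
        g ` tooth G i = tooth G j \<and> g ` tooth_ends G i = tooth_ends G j)"

definition gear_movement ::
  "gear \<Rightarrow> nat \<Rightarrow> (nat \<Rightarrow> real^3 \<Rightarrow> real^3) \<Rightarrow> (nat \<Rightarrow> int) \<Rightarrow> bool" where
  "gear_movement G s r f \<longleftrightarrow>
     s > 0 \<and> (\<forall>x\<in>S2. r 0 x = x) \<and> f 0 = 0 \<and>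
     (\<forall>t\<le>s. rotation_about (gear_center G) (r t) \<and> maps_teeth_to_teeth G (r t))"

text \<open>The point \<open>p\<close> of the circle on which the winding map is read off is an explicit argument;
  the value does not depend on it.\<close>

definition winding ::
  "gear \<Rightarrow> (nat \<Rightarrow> real^3 \<Rightarrow> real^3) \<Rightarrow> (nat \<Rightarrow> int) \<Rightarrow> real^3 \<Rightarrow> nat \<Rightarrow> real" where
  "winding G r f p t =
     oriented_angle (gear_orient G) (gear_center G) p (r t p) / (2 * pi / real (gear_size G))
     + real (gear_size G) * real_of_int (f t)"

definition gear_angular_velocity ::
  "gear \<Rightarrow> (nat \<Rightarrow> real^3 \<Rightarrow> real^3) \<Rightarrow> (nat \<Rightarrow> int) \<Rightarrow> real^3 \<Rightarrow> nat \<Rightarrow> real" where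
  "gear_angular_velocity G r f p t =
     2 * pi * winding G r f p t / (real (gear_size G) * real t)"

definition corresponding_movements ::
  "nat \<Rightarrow> gear \<Rightarrow> (nat \<Rightarrow> real^3 \<Rightarrow> real^3) \<Rightarrow> (nat \<Rightarrow> int) \<Rightarrow>
          gear \<Rightarrow> (nat \<Rightarrow> real^3 \<Rightarrow> real^3) \<Rightarrow> (nat \<Rightarrow> int) \<Rightarrow> bool" where
  "corresponding_movements s G1 r1 f1 G2 r2 f2 \<longleftrightarrow>
     gear_movement G1 s r1 f1 \<and> gear_movement G2 s r2 f2 \<and>
     (\<forall>t\<le>s. \<forall>p1\<in>gear_circle G1. \<forall>p2\<in>gear_circle G2.
        winding G1 r1 f1 p1 t = winding G2 r2 f2 p2 t)"

definition attached :: "gear \<Rightarrow> gear \<Rightarrow> bool" where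
  "attached G1 G2 \<longleftrightarrow>
     is_gear G1 \<and> is_gear G2 \<and>
     (\<forall>i<gear_size G1. \<forall>j<gear_size G2. tooth_length G1 i = tooth_length G2 j) \<and>
     (\<forall>s r1 f1. gear_movement G1 s r1 f1 \<longrightarrow>
        (\<exists>r2 f2. corresponding_movements s G1 r1 f1 G2 r2 f2)) \<and>
     (\<forall>s r2 f2. gear_movement G2 s r2 f2 \<longrightarrow>
        (\<exists>r1 f1. corresponding_movements s G1 r1 f1 G2 r2 f2))"

section \<open>Pulleys\<close>

text \<open>The isometry group is the orthogonal group, on which the entries of the matrix, i.e.
  the images of the three standard basis vectors, are smooth coordinates. Hence a path of
  isometries is differentiable iff all its orbits are.\<close>

definition pulley_movement ::
  "real^3 \<Rightarrow> real \<Rightarrow> (real \<Rightarrow> real^3 \<Rightarrow> real^3) \<Rightarrow> bool" where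
  "pulley_movement c s r \<longleftrightarrow>
     s > 0 \<and> (\<forall>x\<in>S2. r 0 x = x) \<and>
     (\<forall>x\<in>S2. (\<lambda>t. r t x) differentiable_on {0..s}) \<and>
     (\<forall>t\<in>{0..s}. rotation_about c (r t))"

definition linear_velocity :: "real \<Rightarrow> (real \<Rightarrow> real^3) \<Rightarrow> real \<Rightarrow> real^3" where
  "linear_velocity s \<gamma> t = vector_derivative \<gamma> (at t within {0..s})"

text \<open>\<open>\<alpha>\<close> is a continuous choice of the oriented angle at \<open>c\<close> from the geodesic segment with
  initial unit tangent vector \<open>e\<close> to the segment from \<open>c\<close> to \<open>\<gamma> t\<close>.\<close>

definition angle_function ::
  "real^3 \<Rightarrow> real^3 \<Rightarrow> real \<Rightarrow> (real \<Rightarrow> real^3) \<Rightarrow> (real \<Rightarrow> real) \<Rightarrow> bool" where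
  "angle_function c e s \<gamma> \<alpha> \<longleftrightarrow>
     continuous_on {0..s} \<alpha> \<and>
     (\<forall>t\<in>{0..s}. segment_dir c (\<gamma> t) = cos (\<alpha> t) *\<^sub>R e + sin (\<alpha> t) *\<^sub>R cross3 c e)"

definition angular_velocity :: "real^3 \<Rightarrow> real \<Rightarrow> (real \<Rightarrow> real^3) \<Rightarrow> real \<Rightarrow> real" where
  "angular_velocity c s \<gamma> t =
     (THE w. \<exists>e \<alpha>. norm e = 1 \<and> c \<bullet> e = 0 \<and> angle_function c e s \<gamma> \<alpha> \<and>
        w = \<bar>vector_derivative \<alpha> (at t within {0..s})\<bar>)"

definition belt_attached ::
  "real \<Rightarrow> real^3 \<Rightarrow> real \<Rightarrow> (real \<Rightarrow> real^3 \<Rightarrow> real^3) \<Rightarrow>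
           real^3 \<Rightarrow> real \<Rightarrow> (real \<Rightarrow> real^3 \<Rightarrow> real^3) \<Rightarrow> bool" where
  "belt_attached s c1 R1 r1 c2 R2 r2 \<longleftrightarrow>
     (\<forall>t\<in>{0..s}. \<forall>p1\<in>sphere_circle c1 R1. \<forall>p2\<in>sphere_circle c2 R2.
        norm (linear_velocity s (\<lambda>u. r1 u p1) t) = norm (linear_velocity s (\<lambda>u. r2 u p2) t))"

end

theory Submission
  imports Defs
begin

text \<open>Both halves compare linear quantities measured along the two circles, and a circle of
  spherical radius \<open>R\<close> on the unit sphere is a Euclidean circle of radius \<open>sin R\<close>.

  Gears: arc length on the circle is \<open>sin R\<close> times the angle, so the \<open>n\<close> congruent teeth of a
  gear have total length \<open>2 * pi * sin R\<close> (\<open>teeth_total_length\<close>). A common tooth length of two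
  attached gears therefore makes \<open>sin R / n\<close> the same for both. The angular velocity is
  \<open>2 * pi / (n * t)\<close> times the winding map, and corresponding movements have the same winding map.

  Pulleys: a point of the pulley stays on its circle, so in an orthonormal frame \<open>e\<close>, \<open>c \<times> e\<close>
  of the plane orthogonal to \<open>c\<close> its orbit is
  \<open>cos R *\<^sub>R c + sin R *\<^sub>R (cos \<alpha> *\<^sub>R e + sin \<alpha> *\<^sub>R (c \<times> e))\<close>
  with a continuous angle \<open>\<alpha>\<close>. The angle exists by lifting to the universal cover of the unit circle
  (\<open>unit_curve_continuous_angle\<close>), it is differentiable because the orbit is
  (\<open>continuous_angle_differentiable\<close>), and the linear speed is \<open>sin R * \<bar>\<alpha>'\<bar>\<close> for every choice of
  frame and angle. Thus the angular velocity is well defined and \<open>sin R\<close> times it is the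
  linear speed (\<open>sin_radius_times_angular_velocity\<close>), which the belt makes equal on both
  pulleys.\<close>

section \<open>Circles on the sphere\<close>

lemma sphere_circle_inner:
  assumes "c \<in> S2" "p \<in> sphere_circle c R"
  shows "norm p = 1" "c \<bullet> p = cos R"
proof -
  show p: "norm p = 1" using assms(2) by (simp add: sphere_circle_def)
  have "\<bar>c \<bullet> p\<bar> \<le> 1" using Cauchy_Schwarz_ineq2[of c p] assms(1) p by simp
  then show "c \<bullet> p = cos R"
    using assms(2) by (auto simp: sphere_circle_def sdist_def intro!: cos_arccos_abs[symmetric])
qed

lemma sphere_circle_euclidean_radius:
  assumes "c \<in> S2" "p \<in> sphere_circle c R" "0 < R" "R < pi"
  shows "norm (p - (c \<bullet> p) *\<^sub>R c) = sin R"
proof -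
  note ip = sphere_circle_inner[OF assms(1,2)]
  have c: "c \<bullet> c = 1" and p: "p \<bullet> p = 1"
    using assms(1) ip(1) by (auto simp: dot_square_norm)
  have "(norm (p - (c \<bullet> p) *\<^sub>R c))\<^sup>2 = 1 - (cos R)\<^sup>2"
    unfolding power2_norm_eq_inner
    by (simp add: inner_diff inner_commute[of p c] ip c p power2_eq_square)
  also have "\<dots> = (sin R)\<^sup>2" by (simp add: sin_squared_eq)
  finally show ?thesis using sin_gt_zero[OF assms(3,4)] by simp
qed

lemma segment_dir_on_circle:
  assumes "c \<in> S2" "p \<in> sphere_circle c R" "0 < R" "R < pi"
  shows "segment_dir c p = (1 / sin R) *\<^sub>R (p - cos R *\<^sub>R c)"
  using sphere_circle_euclidean_radius[OF assms] sphere_circle_inner(2)[OF assms(1,2)]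
  by (simp add: segment_dir_def sgn_div_norm divide_inverse)

text \<open>For \<open>d = c \<times> e\<close> the component \<open>w\<close> of \<open>u\<close> orthogonal to \<open>c\<close>, \<open>e\<close>, \<open>d\<close> satisfies
  \<open>d \<times> w = 0\<close> by the triple product expansion, although \<open>d\<close> is a unit vector orthogonal to \<open>w\<close>;
  hence \<open>w = 0\<close>.\<close>

lemma cross3_frame_expansion:
  fixes c e u :: "real^3"
  assumes "norm c = 1" "norm e = 1" "c \<bullet> e = 0" "c \<bullet> u = 0"
  shows "u = (u \<bullet> e) *\<^sub>R e + (u \<bullet> cross3 c e) *\<^sub>R cross3 c e"
proof -
  define d where "d = cross3 c e"
  define w where "w = u - (u \<bullet> e) *\<^sub>R e - (u \<bullet> d) *\<^sub>R d"
  have "(norm d)\<^sup>2 = 1"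
    using norm_cross_dot[of c e] assms by (simp add: d_def)
  then have d: "norm d = 1" "d \<bullet> d = 1"
    using norm_ge_zero[of d] by (auto simp: power2_eq_1_iff dot_square_norm)
  have e: "e \<bullet> e = 1" using assms by (simp add: dot_square_norm)
  have cd: "c \<bullet> d = 0" "e \<bullet> d = 0" by (simp_all add: d_def dot_cross_self)
  have w: "c \<bullet> w = 0" "e \<bullet> w = 0" "d \<bullet> w = 0"
    using assms d e cd by (simp_all add: w_def inner_diff inner_commute)
  have "cross3 d w = (c \<bullet> w) *\<^sub>R e - (e \<bullet> w) *\<^sub>R c"
    unfolding d_def using Lagrange[of w c e] cross_skew[of "cross3 c e" w] by (simp add: inner_commute)
  then have "cross3 d w = 0" using w by simp
  then have "norm w = 0" using norm_cross_dot[of d w] w d by simp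
  then show ?thesis by (simp add: w_def d_def algebra_simps)
qed

lemma cross3_unit:
  fixes c e :: "real^3"
  assumes "norm c = 1" "norm e = 1" "c \<bullet> e = 0"
  shows "norm (cross3 c e) = 1"
proof -
  have "(norm (cross3 c e))\<^sup>2 = 1" using norm_cross_dot[of c e] assms by simp
  then show ?thesis using norm_ge_zero[of "cross3 c e"] by (auto simp: power2_eq_1_iff)
qed

section \<open>Gears\<close>

lemma turn_speed:
  assumes "c \<in> S2" "p \<in> sphere_circle c R" "0 < R" "R < pi" "\<epsilon> \<in> {1, -1}"
  shows "norm (vector_derivative (turn \<epsilon> c p) (at x)) = sin R"
proof -
  define q where "q = p - (c \<bullet> p) *\<^sub>R c"
  have c: "norm c = 1" using assms(1) by simp
  have q: "norm q = sin R" using sphere_circle_euclidean_radius[OF assms(1-4)] by (simp add: q_def)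
  have cq: "c \<bullet> q = 0" using c by (simp add: q_def inner_diff dot_square_norm)
  have cr: "cross3 c p = cross3 c q"
    by (simp add: q_def Cross3.right_diff_distrib cross_mult_right)
  have "(norm (cross3 c q))\<^sup>2 = (norm q)\<^sup>2" using norm_cross_dot[of c q] c cq by simp
  then have n: "cross3 c q \<bullet> cross3 c q = (sin R)\<^sup>2" "q \<bullet> q = (sin R)\<^sup>2"
    using q by (simp_all add: dot_square_norm)
  have o: "q \<bullet> cross3 c q = 0" "cross3 c q \<bullet> q = 0" by (simp_all add: dot_cross_self)
  have "(turn \<epsilon> c p has_vector_derivative
      (- sin x) *\<^sub>R q + (\<epsilon> * cos x) *\<^sub>R cross3 c q) (at x)"
    unfolding turn_def cr q_def[symmetric]
    by (auto intro!: derivative_eq_intros simp: has_real_derivative_iff_has_vector_derivative[symmetric])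
  then have v: "vector_derivative (turn \<epsilon> c p) (at x) = (- sin x) *\<^sub>R q + (\<epsilon> * cos x) *\<^sub>R cross3 c q"
    by (rule vector_derivative_at)
  have "(norm (vector_derivative (turn \<epsilon> c p) (at x)))\<^sup>2
      = ((sin x)\<^sup>2 + \<epsilon>\<^sup>2 * (cos x)\<^sup>2) * (sin R)\<^sup>2"
    unfolding v power2_norm_eq_inner
    by (simp add: inner_add inner_diff n o power2_eq_square algebra_simps)
  also have "\<dots> = (sin R)\<^sup>2" using assms(5) by auto
  finally show ?thesis using sin_gt_zero[OF assms(3,4)] by simp
qed

lemma tooth_length_angle:
  assumes "is_gear G" "i < gear_size G"
  shows "tooth_length G i = sin (gear_radius G) * (gear_angle G (Suc i) - gear_angle G i)"
proof -
  have "norm (vector_derivative (gear_path G) (at x)) = sin (gear_radius G)" for x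
    unfolding gear_path_def using assms(1)
    by (intro turn_speed) (auto simp: is_gear_def gear_circle_def)
  moreover have "gear_angle G i \<le> gear_angle G (Suc i)"
    using assms by (auto simp: is_gear_def intro: less_imp_le)
  ultimately show ?thesis by (simp add: tooth_length_def curve_length_def)
qed

lemma teeth_total_length:
  assumes "is_gear G" "j < gear_size G"
  shows "real (gear_size G) * tooth_length G j = 2 * pi * sin (gear_radius G)"
proof -
  have ends: "gear_angle G 0 = 0" "gear_angle G (gear_size G) = 2 * pi"
    using assms(1) unfolding is_gear_def by blast+
  have "real (gear_size G) * tooth_length G j = (\<Sum>i<gear_size G. tooth_length G j)" by simp
  also have "\<dots> = (\<Sum>i<gear_size G. tooth_length G i)"
    using assms unfolding is_gear_def by (intro sum.cong refl) blast
  also have "\<dots> = sin (gear_radius G) * (\<Sum>i<gear_size G. gear_angle G (Suc i) - gear_angle G i)"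
    by (simp add: tooth_length_angle[OF assms(1)] sum_distrib_left)
  also have "\<dots> = 2 * pi * sin (gear_radius G)"
    using ends by (simp add: sum_lessThan_telescope)
  finally show ?thesis .
qed

lemma attached_gears_angular_velocity:
  assumes "attached G1 G2" "corresponding_movements s G1 r1 f1 G2 r2 f2" "t \<le> s"
    and "p1 \<in> gear_circle G1" "p2 \<in> gear_circle G2"
  shows "sin (gear_radius G1) * gear_angular_velocity G1 r1 f1 p1 t =
         sin (gear_radius G2) * gear_angular_velocity G2 r2 f2 p2 t"
proof -
  have g: "is_gear G1" "is_gear G2" using assms(1) by (auto simp: attached_def)
  then have n: "0 < gear_size G1" "0 < gear_size G2" by (auto simp: is_gear_def)
  then have "tooth_length G1 0 = tooth_length G2 0" using assms(1) by (auto simp: attached_def)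
  then have L: "2 * pi * sin (gear_radius G1) / real (gear_size G1)
      = 2 * pi * sin (gear_radius G2) / real (gear_size G2)"
    using teeth_total_length[OF g(1) n(1)] teeth_total_length[OF g(2) n(2)] n
    by (metis nonzero_mult_div_cancel_left of_nat_0_less_iff less_numeral_extra(3))
  have W: "winding G1 r1 f1 p1 t = winding G2 r2 f2 p2 t"
    using assms by (auto simp: corresponding_movements_def)
  have "sin (gear_radius G1) * gear_angular_velocity G1 r1 f1 p1 t
      = (2 * pi * sin (gear_radius G1) / real (gear_size G1)) * (winding G1 r1 f1 p1 t / real t)"
    by (simp add: gear_angular_velocity_def)
  also have "\<dots> = sin (gear_radius G2) * gear_angular_velocity G2 r2 f2 p2 t"
    unfolding L W by (simp add: gear_angular_velocity_def)
  finally show ?thesis .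
qed

section \<open>Continuous angles\<close>

text \<open>An interval is contractible, so the curve, read as a nonvanishing complex function in the
  frame \<open>e\<close>, \<open>c \<times> e\<close>, has a continuous logarithm. Its imaginary part is the angle.\<close>

lemma unit_curve_continuous_angle:
  fixes c e :: "real^3" and u :: "real \<Rightarrow> real^3"
  assumes "norm c = 1" "norm e = 1" "c \<bullet> e = 0"
    and cont: "continuous_on {a..b} u"
    and unit: "\<forall>t\<in>{a..b}. norm (u t) = 1 \<and> c \<bullet> u t = 0"
  shows "\<exists>\<alpha>. continuous_on {a..b} \<alpha> \<and>
    (\<forall>t\<in>{a..b}. u t = cos (\<alpha> t) *\<^sub>R e + sin (\<alpha> t) *\<^sub>R cross3 c e)"
proof -
  define d where "d = cross3 c e"
  have u: "norm (u t) = 1" "c \<bullet> u t = 0" if "t \<in> {a..b}" for t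
    using unit that by blast+
  define z where "z t = Complex (u t \<bullet> e) (u t \<bullet> d)" for t
  have ex: "u t = (u t \<bullet> e) *\<^sub>R e + (u t \<bullet> d) *\<^sub>R d" if "t \<in> {a..b}" for t
    using cross3_frame_expansion[OF assms(1-3), of "u t"] u[OF that] by (simp add: d_def)
  have z1: "cmod (z t) = 1" if t: "t \<in> {a..b}" for t
  proof -
    have "u t \<bullet> u t = u t \<bullet> ((u t \<bullet> e) *\<^sub>R e + (u t \<bullet> d) *\<^sub>R d)" using ex[OF t] by simp
    also have "\<dots> = (u t \<bullet> e)\<^sup>2 + (u t \<bullet> d)\<^sup>2" by (simp add: inner_add_right power2_eq_square)
    finally show ?thesis using u[OF t] by (simp add: z_def cmod_def dot_square_norm)
  qed
  have "continuous_on {a..b} z"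
    unfolding z_def Complex_eq by (intro continuous_intros cont)
  moreover have "contractible {a..b}" by (simp add: convex_imp_contractible)
  moreover have "z t \<noteq> 0" if "t \<in> {a..b}" for t using z1[OF that] by auto
  ultimately obtain g where g: "continuous_on {a..b} g" "\<And>t. t \<in> {a..b} \<Longrightarrow> z t = exp (g t)"
    using continuous_logarithm_on_contractible[of "{a..b}" z] by metis
  have "u t = cos (Im (g t)) *\<^sub>R e + sin (Im (g t)) *\<^sub>R cross3 c e" if t: "t \<in> {a..b}" for t
  proof -
    have "exp (Re (g t)) = 1" using z1[OF t] g(2)[OF t] by simp
    then have "Re (z t) = cos (Im (g t))" "Im (z t) = sin (Im (g t))"
      using g(2)[OF t] by (simp_all add: Re_exp Im_exp)
    then show ?thesis using ex[OF t] by (simp add: z_def d_def)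
  qed
  then show ?thesis using continuous_on_Im[OF g(1)] by blast
qed

text \<open>Near \<open>t\<close> a continuous \<open>\<alpha>\<close> stays within a quarter turn of \<open>\<alpha> t\<close>, where the sine is inverted
  by the differentiable function \<open>arcsin\<close>.\<close>

lemma continuous_angle_differentiable:
  fixes \<alpha> :: "real \<Rightarrow> real"
  assumes cont: "continuous_on S \<alpha>" and t: "t \<in> S"
    and h: "((\<lambda>u. sin (\<alpha> u - \<alpha> t)) has_real_derivative D) (at t within S)"
  shows "(\<alpha> has_real_derivative D) (at t within S)"
proof -
  have "((\<lambda>u. arcsin (sin (\<alpha> u - \<alpha> t)) + \<alpha> t) has_real_derivative D) (at t within S)"
    by (rule derivative_eq_intros h refl | simp)+
  moreover have "(\<alpha> \<longlongrightarrow> \<alpha> t) (at t within S)"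
    using cont t by (simp add: continuous_on_def)
  then have "eventually (\<lambda>u. dist (\<alpha> u) (\<alpha> t) < pi / 2) (at t within S)"
    by (rule tendstoD) simp
  then have "eventually (\<lambda>u. arcsin (sin (\<alpha> u - \<alpha> t)) + \<alpha> t = \<alpha> u) (at t within S)"
  proof eventually_elim
    case (elim u)
    then have "- (pi / 2) \<le> \<alpha> u - \<alpha> t" "\<alpha> u - \<alpha> t \<le> pi / 2"
      unfolding dist_real_def by linarith+
    then have "arcsin (sin (\<alpha> u - \<alpha> t)) = \<alpha> u - \<alpha> t" by (rule arcsin_sin)
    then show ?case by simp
  qed
  ultimately show ?thesis
    unfolding has_field_derivative_def
    by (rule has_derivative_transform_eventually) (simp_all add: t)
qed

section \<open>Pulleys\<close>

text \<open>The angle is only assumed continuous, so its differentiability comes first; the chain rule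
  applied to the parametrisation of the circle by the angle then gives the speed.\<close>

lemma circle_motion_speed:
  fixes c e :: "real^3"
  assumes c: "c \<in> S2" and R: "0 < R" "R < pi" and s: "0 < s" and t: "t \<in> {0..s}"
    and on: "\<And>u. u \<in> {0..s} \<Longrightarrow> \<gamma> u \<in> sphere_circle c R"
    and diff: "\<gamma> differentiable_on {0..s}"
    and e: "norm e = 1" "c \<bullet> e = 0" and ang: "angle_function c e s \<gamma> \<alpha>"
  shows "norm (linear_velocity s \<gamma> t) = sin R * \<bar>vector_derivative \<alpha> (at t within {0..s})\<bar>"
proof -
  define d where "d = cross3 c e"
  have sR: "sin R > 0" using sin_gt_zero[OF R] .
  have c1: "norm c = 1" using c by simp
  have d: "d \<bullet> d = 1" "e \<bullet> e = 1" "e \<bullet> d = 0" "d \<bullet> e = 0" "c \<bullet> d = 0"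
    using cross3_unit[OF c1 e] e by (auto simp: d_def dot_square_norm dot_cross_self)
  have nb: "at t within {0..s} \<noteq> bot" using s t trivial_limit_within islimpt_Icc by blast
  have \<gamma>: "\<gamma> u = cos R *\<^sub>R c + sin R *\<^sub>R (cos (\<alpha> u) *\<^sub>R e + sin (\<alpha> u) *\<^sub>R d)"
    if u: "u \<in> {0..s}" for u
  proof -
    have "cos (\<alpha> u) *\<^sub>R e + sin (\<alpha> u) *\<^sub>R d = (1 / sin R) *\<^sub>R (\<gamma> u - cos R *\<^sub>R c)"
      using ang u segment_dir_on_circle[OF c on[OF u] R] by (simp add: angle_function_def d_def)
    then show ?thesis using sR by simp
  qed
  \<comment> \<open>The unit tangent at time \<open>t\<close>, scaled so that the inner product with the orbit is the sine
    of the angle difference: this transfers differentiability from the orbit to that sine.\<close>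
  define N where "N = (1 / sin R) *\<^sub>R (cos (\<alpha> t) *\<^sub>R d - sin (\<alpha> t) *\<^sub>R e)"
  have N: "\<gamma> u \<bullet> N = sin (\<alpha> u - \<alpha> t)" if "u \<in> {0..s}" for u
    using \<gamma>[OF that] sR d e
    by (simp add: N_def inner_add inner_diff sin_diff field_simps)
  have v: "(\<gamma> has_vector_derivative linear_velocity s \<gamma> t) (at t within {0..s})"
    using diff t by (auto simp: linear_velocity_def differentiable_on_def vector_derivative_works)
  define D where "D = linear_velocity s \<gamma> t \<bullet> N"
  have "((\<lambda>u. \<gamma> u \<bullet> N) has_real_derivative D) (at t within {0..s})"
    unfolding D_def has_real_derivative_iff_has_vector_derivative
    by (rule bounded_linear.has_vector_derivative[OF bounded_linear_inner_left v])
  then have "((\<lambda>u. sin (\<alpha> u - \<alpha> t)) has_real_derivative D) (at t within {0..s})"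
    by (rule has_field_derivative_transform_within[OF _ zero_less_one t]) (simp add: N)
  moreover have "continuous_on {0..s} \<alpha>" using ang by (simp add: angle_function_def)
  ultimately have \<alpha>: "(\<alpha> has_real_derivative D) (at t within {0..s})"
    using continuous_angle_differentiable t by blast
  then have vD: "vector_derivative \<alpha> (at t within {0..s}) = D"
    by (intro vector_derivative_within[OF nb])
       (simp add: has_real_derivative_iff_has_vector_derivative)
  define V where "V = (sin R * D) *\<^sub>R (cos (\<alpha> t) *\<^sub>R d - sin (\<alpha> t) *\<^sub>R e)"
  have "((\<lambda>u. cos R *\<^sub>R c + sin R *\<^sub>R (cos (\<alpha> u) *\<^sub>R e + sin (\<alpha> u) *\<^sub>R d))
      has_vector_derivative V) (at t within {0..s})"
    unfolding V_def
    by (auto intro!: derivative_eq_intros \<alpha> simp: algebra_simps)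
  then have "(\<gamma> has_vector_derivative V) (at t within {0..s})"
    by (rule has_vector_derivative_transform[OF t, rotated]) (simp add: \<gamma>)
  then have lv: "linear_velocity s \<gamma> t = V"
    unfolding linear_velocity_def by (rule vector_derivative_within[OF nb])
  have "(norm (cos (\<alpha> t) *\<^sub>R d - sin (\<alpha> t) *\<^sub>R e))\<^sup>2 = (cos (\<alpha> t))\<^sup>2 + (sin (\<alpha> t))\<^sup>2"
    unfolding power2_norm_eq_inner by (simp add: inner_diff d power2_eq_square)
  then have "norm (cos (\<alpha> t) *\<^sub>R d - sin (\<alpha> t) *\<^sub>R e) = 1"
    using power2_eq_1_iff norm_ge_zero by (smt (verit) sin_cos_squared_add2)
  then show ?thesis using sR by (simp add: lv vD V_def abs_mult)
qed

lemma circle_motion_angle_exists: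
  assumes c: "c \<in> S2" and R: "0 < R" "R < pi" and s: "0 < s"
    and on: "\<And>u. u \<in> {0..s} \<Longrightarrow> \<gamma> u \<in> sphere_circle c R"
    and cont: "continuous_on {0..s} \<gamma>"
  obtains e \<alpha> where "norm e = 1" "c \<bullet> e = 0" "angle_function c e s \<gamma> \<alpha>"
proof -
  define u where "u t = segment_dir c (\<gamma> t)" for t
  have c1: "norm c = 1" using c by simp
  have sR: "sin R > 0" using sin_gt_zero[OF R] .
  have u: "u t = (1 / sin R) *\<^sub>R (\<gamma> t - cos R *\<^sub>R c)" if "t \<in> {0..s}" for t
    unfolding u_def by (rule segment_dir_on_circle[OF c on[OF that] R])
  have unit: "norm (u t) = 1 \<and> c \<bullet> u t = 0" if t: "t \<in> {0..s}" for t
    using sphere_circle_euclidean_radius[OF c on[OF t] R] sphere_circle_inner(2)[OF c on[OF t]] sR c1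
    by (simp add: u[OF t] inner_diff dot_square_norm)
  have "continuous_on {0..s} (\<lambda>t. (1 / sin R) *\<^sub>R (\<gamma> t - cos R *\<^sub>R c))"
    by (intro continuous_intros cont)
  then have cu: "continuous_on {0..s} u" by (rule continuous_on_eq) (simp add: u)
  have u0: "norm (u 0) = 1" "c \<bullet> u 0 = 0" using unit[of 0] s by auto
  obtain \<alpha> where "continuous_on {0..s} \<alpha>"
    "\<forall>t\<in>{0..s}. u t = cos (\<alpha> t) *\<^sub>R u 0 + sin (\<alpha> t) *\<^sub>R cross3 c (u 0)"
    using unit_curve_continuous_angle[OF c1 u0 cu] unit by blast
  then have "angle_function c (u 0) s \<gamma> \<alpha>" unfolding angle_function_def u_def[symmetric] by blast
  with u0 show ?thesis using that by blast
qed

lemma pulley_orbit_on_circle: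
  assumes "c \<in> S2" "pulley_movement c s r" "p \<in> sphere_circle c R" "t \<in> {0..s}"
  shows "r t p \<in> sphere_circle c R"
proof -
  have "rotation_about c (r t)" using assms by (auto simp: pulley_movement_def)
  then have fix_c: "r t c = c" and bij: "bij_betw (r t) S2 S2"
    and iso: "\<And>x y. x \<in> S2 \<Longrightarrow> y \<in> S2 \<Longrightarrow> sdist (r t x) (r t y) = sdist x y"
    by (auto simp: rotation_about_def sphere_isometry_def)
  have p: "p \<in> S2" "sdist c p = R" using assms(3) by (auto simp: sphere_circle_def)
  have "sdist c (r t p) = R" using iso[OF assms(1) p(1)] fix_c p(2) by simp
  moreover have "r t p \<in> S2" using bij p(1) by (rule bij_betw_apply)
  ultimately show ?thesis by (simp add: sphere_circle_def)
qed

text \<open>The defining property of the angular velocity determines it because every admissible frame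
  and angle give the linear speed divided by \<open>sin R\<close>.\<close>

lemma sin_radius_times_angular_velocity:
  assumes c: "c \<in> S2" and R: "0 < R" "R < pi" and r: "pulley_movement c s r"
    and p: "p \<in> sphere_circle c R" and t: "t \<in> {0..s}"
  shows "sin R * angular_velocity c s (\<lambda>u. r u p) t = norm (linear_velocity s (\<lambda>u. r u p) t)"
proof -
  have s: "0 < s" using r by (simp add: pulley_movement_def)
  have on: "\<And>u. u \<in> {0..s} \<Longrightarrow> r u p \<in> sphere_circle c R"
    by (rule pulley_orbit_on_circle[OF c r p])
  have diff: "(\<lambda>u. r u p) differentiable_on {0..s}"
    using r p by (auto simp: pulley_movement_def sphere_circle_def)
  have sR: "sin R > 0" using sin_gt_zero[OF R] .
  have speed: "\<bar>vector_derivative \<alpha> (at t within {0..s})\<bar>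
      = norm (linear_velocity s (\<lambda>u. r u p) t) / sin R"
    if "norm e = 1" "c \<bullet> e = 0" "angle_function c e s (\<lambda>u. r u p) \<alpha>" for e \<alpha>
    using circle_motion_speed[OF c R s t on diff that] sR by simp
  obtain e \<alpha> where "norm e = 1" "c \<bullet> e = 0" "angle_function c e s (\<lambda>u. r u p) \<alpha>"
    using circle_motion_angle_exists[OF c R s on differentiable_imp_continuous_on[OF diff]] by blast
  then have "angular_velocity c s (\<lambda>u. r u p) t
      = norm (linear_velocity s (\<lambda>u. r u p) t) / sin R"
    unfolding angular_velocity_def using speed by (intro the_equality) (metis, auto)
  then show ?thesis using sR by simp
qed

section \<open>Angular velocities of attached gears and pulleys\<close>

theorem mainTheorem3:
  fixes c1 c2 :: "real^3" and R1 R2 :: real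
  assumes "c1 \<in> S2" and "c2 \<in> S2"
    and "0 < R1" and "R1 < pi" and "0 < R2" and "R2 < pi"
  shows "(\<forall>G1 G2 s r1 f1 r2 f2.
            gear_center G1 = c1 \<and> gear_radius G1 = R1 \<and>
            gear_center G2 = c2 \<and> gear_radius G2 = R2 \<and>
            attached G1 G2 \<and> corresponding_movements s G1 r1 f1 G2 r2 f2 \<longrightarrow>
            (\<forall>t\<in>{1..s}. \<forall>p1\<in>sphere_circle c1 R1. \<forall>p2\<in>sphere_circle c2 R2.
               sin R1 * gear_angular_velocity G1 r1 f1 p1 t =
               sin R2 * gear_angular_velocity G2 r2 f2 p2 t)) \<and>
         (\<forall>s r1 r2.
            pulley_movement c1 s r1 \<and> pulley_movement c2 s r2 \<and>
            belt_attached s c1 R1 r1 c2 R2 r2 \<longrightarrow>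
            (\<forall>t\<in>{0..s}. \<forall>p1\<in>sphere_circle c1 R1. \<forall>p2\<in>sphere_circle c2 R2.
               sin R1 * angular_velocity c1 s (\<lambda>u. r1 u p1) t =
               sin R2 * angular_velocity c2 s (\<lambda>u. r2 u p2) t))"
proof (rule conjI; intro allI impI ballI)
  fix G1 G2 s r1 f1 r2 f2 t p1 p2
  assume gears: "gear_center G1 = c1 \<and> gear_radius G1 = R1 \<and>
      gear_center G2 = c2 \<and> gear_radius G2 = R2 \<and>
      attached G1 G2 \<and> corresponding_movements s G1 r1 f1 G2 r2 f2"
    and t: "t \<in> {1..s}"
    and p: "p1 \<in> sphere_circle c1 R1" "p2 \<in> sphere_circle c2 R2"
  from gears have G: "gear_center G1 = c1" "gear_radius G1 = R1"
      "gear_center G2 = c2" "gear_radius G2 = R2"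
    and moves: "attached G1 G2" "corresponding_movements s G1 r1 f1 G2 r2 f2"
    by blast+
  have "p1 \<in> gear_circle G1" "p2 \<in> gear_circle G2"
    using p unfolding gear_circle_def G by blast+
  with moves t show "sin R1 * gear_angular_velocity G1 r1 f1 p1 t =
      sin R2 * gear_angular_velocity G2 r2 f2 p2 t"
    using attached_gears_angular_velocity unfolding G[symmetric] by simp
next
  fix s r1 r2 t p1 p2
  assume pulleys: "pulley_movement c1 s r1 \<and> pulley_movement c2 s r2 \<and>
      belt_attached s c1 R1 r1 c2 R2 r2"
    and t: "t \<in> {0..s}"
    and p: "p1 \<in> sphere_circle c1 R1" "p2 \<in> sphere_circle c2 R2"
  from pulleys have r: "pulley_movement c1 s r1" "pulley_movement c2 s r2"
    and belt: "belt_attached s c1 R1 r1 c2 R2 r2"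
    by blast+
  have "norm (linear_velocity s (\<lambda>u. r1 u p1) t) = norm (linear_velocity s (\<lambda>u. r2 u p2) t)"
    using belt t p unfolding belt_attached_def by blast
  then show "sin R1 * angular_velocity c1 s (\<lambda>u. r1 u p1) t =
      sin R2 * angular_velocity c2 s (\<lambda>u. r2 u p2) t"
    using sin_radius_times_angular_velocity[OF assms(1,3,4) r(1) p(1) t]
      sin_radius_times_angular_velocity[OF assms(2,5,6) r(2) p(2) t] by simp
qed

end
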